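(* Let $R$ be a commutative ring with $1\neq 0$ and let $\tau$ be a symmetric relation on $R^{\#}$. Let $\alpha\in\{$atomic, strongly atomic, m-atomic, unrefinably atomic, very strongly atomic$\}$ and $\beta\in\{$associate, strong associate, very strong associate$\}$. Then the following hold. (1) If $R$ is a $\tau$-$\alpha$-$\beta$-UFR, then $R$ is a $\tau$-$r$-UFR. (2) If $R$ is a $\tau$-$\alpha$-HFR, then $R$ is a $\tau$-$r$-HFR. (3) If $R$ is a $\tau$-$\beta$-FFR, then $R$ is a $\tau$-$r$-FFR. (4) If $R$ is a $\tau$-$\beta$-WFFR, then $R$ is a $\tau$-$r$-WFFR. (5) If $R$ is a $\tau$-$\alpha$-$\beta$-df ring, then $R$ is a $\tau$-$r$-idf ring. (6) If $R$ is a $\tau$-BFR, then $R$ is a $\tau$-$r$-BFR. (7) If $R$ satisfies $\tau$-ACCP, then $R$ satisfies $\tau$-$r$-ACCP. (8) If $R$ is $\tau$-$\alpha$, then $R$ is $\tau$-$r$-atomic.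
   Context: $U(R)$ is the group of units of $R$, $R^{\#}$ the set of nonzero non-units, $\mathrm{Reg}(R)$ the set of regular elements (non-zero-divisors), $\mathrm{Reg}(R)^{\#}$ the set of regular non-units. $a\sim b$ (associates) means $(a)=(b)$; $a\approx b$ (strong associates) means $a=\lambda b$ for some $\lambda\in U(R)$; $a\cong b$ (very strong associates) means $a\sim b$ and either $a=b=0$ or, whenever $a=rb$ with $r\in R$, one has $r\in U(R)$. A $\tau$-factorization of a non-unit $a$ is an expression $a=\lambda a_1\cdots a_n$, $n\ge1$, $\lambda\in U(R)$, each $a_i$ a non-unit, $a_i\,\tau\,a_j$ for all $i\ne j$; it is trivial if $n=1$. The $a_i$ are its $\tau$-factors, or $\tau$-divisors of $a$, and $b\mid_\tau a$ means $b$ is a $\tau$-factor in some $\tau$-factorization of $a$; a non-trivial $\tau$-divisor is a factor of a non-trivial $\tau$-factorization. A non-unit $a$ is $\tau$-atomic (resp. $\tau$-strongly atomic, $\tau$-m-atomic) if for every $\tau$-factorization $a=\lambda a_1\cdots a_n$ one has $a\sim a_i$ for some $i$ (resp. $a\approx a_i$ for some $i$, $a\sim a_i$ for all $i$); $a$ is $\tau$-unrefinably atomic if it has only trivial $\tau$-factorizations; $a$ is $\tau$-very strongly atomic if $a\cong a$ and $a$ has no non-trivial $\tau$-factorizations. A $\tau$-$\alpha$-factorization is a $\tau$-factorization all of whose factors are $\tau$-$\alpha$. $R$ is $\tau$-$\alpha$ if every non-unit has a $\tau$-$\alpha$-factorization. $R$ satisfies $\tau$-ACCP if every chain $(a_0)\subseteq(a_1)\subseteq\cdots$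 with $a_{i+1}\mid_\tau a_i$ for all $i$ is eventually constant. $R$ is a $\tau$-$\alpha$-HFR if it is $\tau$-$\alpha$ and any two $\tau$-$\alpha$-factorizations of the same non-unit have the same length; it is a $\tau$-$\alpha$-$\beta$-UFR if moreover the factors can be rearranged so that corresponding ones are $\beta$. $R$ is a $\tau$-BFR if for every non-unit $a$ there is $N(a)\in\mathbb N$ bounding the length of every $\tau$-factorization of $a$. $R$ is a $\tau$-$\beta$-FFR if every non-unit has only finitely many non-trivial $\tau$-factorizations up to rearrangement and $\beta$. $R$ is a $\tau$-$\beta$-WFFR if every non-unit has only finitely many non-trivial $\tau$-divisors up to $\beta$. $R$ is a $\tau$-$\alpha$-$\beta$-df ring if every non-unit has only finitely many $\tau$-$\alpha$ $\tau$-divisors up to $\beta$. $\tau$-$r$-notions ($\tau$-regular notions): a $\tau$-$r$-factorization is a $\tau$-factorization of an element of $\mathrm{Reg}(R)$. A regular non-unit $a$ is $\tau$-$r$-irreducible if for every $\tau$-$r$-factorization $a=\lambda a_1\cdots a_n$ one has $a\sim a_i$ for some $i$ (equivalently, it has only trivial ones). $R$ is $\tau$-$r$-atomic if every $a\in\mathrm{Reg}(R)^{\#}$ has a $\tau$-$r$-factorization into $\tau$-$r$-irreducibles (a $\tau$-$r$-atomic factorization). $R$ satisfies $\tau$-$r$-ACCP if there is no infinite chain $(a_1)\subsetneq(a_2)\subsetneq\cdots$ with all $a_i$ regular and $a_{i+1}$ a $\tau$-factor in some $\tau$-$r$-factorization of $a_i$. $R$ is a $\tau$-$r$-HFR if it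 is $\tau$-$r$-atomic and any two $\tau$-$r$-atomic factorizations of the same element have the same length; a $\tau$-$r$-UFR if moreover the factors can be rearranged to be pairwise associate. $R$ is a $\tau$-$r$-BFR if for each $a\in\mathrm{Reg}(R)$ there is a bound on the lengths of $\tau$-$r$-factorizations of $a$. $R$ is a $\tau$-$r$-idf ring if each $a\in\mathrm{Reg}(R)^{\#}$ has only finitely many $\tau$-$r$-irreducible $\tau$-divisors up to associates; a $\tau$-$r$-WFFR if each $a\in\mathrm{Reg}(R)^{\#}$ has only finitely many $\tau$-divisors up to associates; a $\tau$-$r$-FFR if each $a\in\mathrm{Reg}(R)^{\#}$ has only finitely many $\tau$-factorizations up to order and associates. *)

theory Defs
  imports Main "HOL-Combinatorics.Permutations"
begin

text \<open>
  The ring is the type \<open>'a :: comm_ring_1\<close>; this class includes \<open>0 \<noteq> 1\<close>.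
  A relation \<open>\<tau>\<close> on nonzero non-units is a set of pairs.
\<close>

definition nonunits :: "'a::comm_ring_1 set" where
  "nonunits = {a. \<not> a dvd 1}"

definition nonzero_nonunits :: "'a::comm_ring_1 set" where
  "nonzero_nonunits = nonunits - {0}"

definition Reg :: "'a::comm_ring_1 set" where
  "Reg = {a. \<forall>b. a * b = 0 \<longrightarrow> b = 0}"

definition Reg_nonunits :: "'a::comm_ring_1 set" where
  "Reg_nonunits = Reg \<inter> nonunits"

definition pideal :: "'a::comm_ring_1 \<Rightarrow> 'a set" where
  "pideal a = {r * a |r. True}"

definition assoc :: "'a::comm_ring_1 \<Rightarrow> 'a \<Rightarrow> bool" where
  "assoc a b \<longleftrightarrow> pideal a = pideal b"

definition strong_assoc :: "'a::comm_ring_1 \<Rightarrow> 'a \<Rightarrow> bool" where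
  "strong_assoc a b \<longleftrightarrow> (\<exists>u. u dvd 1 \<and> a = u * b)"

text \<open>Very strong association is not reflexive: it fails at every idempotent
  \<open>e\<close> other than \<open>0\<close> and \<open>1\<close>.\<close>

definition very_strong_assoc :: "'a::comm_ring_1 \<Rightarrow> 'a \<Rightarrow> bool" where
  "very_strong_assoc a b \<longleftrightarrow>
     assoc a b \<and> ((a = 0 \<and> b = 0) \<or> (\<forall>r. a = r * b \<longrightarrow> r dvd 1))"

datatype assoc_kind = Associate | Strong_Associate | Very_Strong_Associate

fun assoc_rel :: "assoc_kind \<Rightarrow> 'a::comm_ring_1 \<Rightarrow> 'a \<Rightarrow> bool" where
  "assoc_rel Associate = assoc"
| "assoc_rel Strong_Associate = strong_assoc"
| "assoc_rel Very_Strong_Associate = very_strong_assoc"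

text \<open>\<open>tau_fact \<tau> a u as\<close>: the expression \<open>a = u * as ! 0 * \<dots> * as ! (n - 1)\<close>, where
  \<open>n = length as\<close>, is a \<open>\<tau>\<close>-factorization of the non-unit \<open>a\<close>.
  It is trivial iff \<open>length as = 1\<close>.\<close>

definition tau_fact :: "'a::comm_ring_1 rel \<Rightarrow> 'a \<Rightarrow> 'a \<Rightarrow> 'a list \<Rightarrow> bool" where
  "tau_fact \<tau> a u as \<longleftrightarrow>
     a \<in> nonunits \<and> u dvd 1 \<and> 1 \<le> length as \<and> a = u * prod_list as \<and>
     set as \<subseteq> nonunits \<and>
     (\<forall>i < length as. \<forall>j < length as. i \<noteq> j \<longrightarrow> (as ! i, as ! j) \<in> \<tau>)"

definition tau_dvd :: "'a::comm_ring_1 rel \<Rightarrow> 'a \<Rightarrow> 'a \<Rightarrow> bool" where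
  "tau_dvd \<tau> b a \<longleftrightarrow> (\<exists>u as. tau_fact \<tau> a u as \<and> b \<in> set as)"

definition nontrivial_tau_dvd :: "'a::comm_ring_1 rel \<Rightarrow> 'a \<Rightarrow> 'a \<Rightarrow> bool" where
  "nontrivial_tau_dvd \<tau> b a \<longleftrightarrow>
     (\<exists>u as. tau_fact \<tau> a u as \<and> length as \<noteq> 1 \<and> b \<in> set as)"

datatype atom_kind =
  Atomic | Strongly_Atomic | M_Atomic | Unrefinably_Atomic | Very_Strongly_Atomic

fun tau_atom :: "'a::comm_ring_1 rel \<Rightarrow> atom_kind \<Rightarrow> 'a \<Rightarrow> bool" where
  "tau_atom \<tau> Atomic a \<longleftrightarrow>
     a \<in> nonunits \<and> (\<forall>u as. tau_fact \<tau> a u as \<longrightarrow> (\<exists>b \<in> set as. assoc a b))"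
| "tau_atom \<tau> Strongly_Atomic a \<longleftrightarrow>
     a \<in> nonunits \<and> (\<forall>u as. tau_fact \<tau> a u as \<longrightarrow> (\<exists>b \<in> set as. strong_assoc a b))"
| "tau_atom \<tau> M_Atomic a \<longleftrightarrow>
     a \<in> nonunits \<and> (\<forall>u as. tau_fact \<tau> a u as \<longrightarrow> (\<forall>b \<in> set as. assoc a b))"
| "tau_atom \<tau> Unrefinably_Atomic a \<longleftrightarrow>
     a \<in> nonunits \<and> (\<forall>u as. tau_fact \<tau> a u as \<longrightarrow> length as = 1)"
| "tau_atom \<tau> Very_Strongly_Atomic a \<longleftrightarrow>
     a \<in> nonunits \<and> very_strong_assoc a a \<and>
     (\<forall>u as. tau_fact \<tau> a u as \<longrightarrow> length as = 1)"

definition tau_atom_fact ::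
  "'a::comm_ring_1 rel \<Rightarrow> atom_kind \<Rightarrow> 'a \<Rightarrow> 'a \<Rightarrow> 'a list \<Rightarrow> bool" where
  "tau_atom_fact \<tau> \<alpha> a u as \<longleftrightarrow> tau_fact \<tau> a u as \<and> (\<forall>b \<in> set as. tau_atom \<tau> \<alpha> b)"

definition rearr :: "('a \<Rightarrow> 'a \<Rightarrow> bool) \<Rightarrow> 'a list \<Rightarrow> 'a list \<Rightarrow> bool" where
  "rearr E as bs \<longleftrightarrow> length as = length bs \<and>
     (\<exists>p. p permutes {..<length as} \<and> (\<forall>i < length as. E (as ! i) (bs ! p i)))"

text \<open>``Finitely many up to \<open>E\<close>''. Below it is applied to the reflexive closure of \<open>\<beta>\<close>
  (for factorizations, to its factorwise extension): an element is always identified with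
  itself, although very strong association is not reflexive. With the closure all these
  relations are equivalence relations.\<close>

definition finite_upto :: "('b \<Rightarrow> 'b \<Rightarrow> bool) \<Rightarrow> 'b set \<Rightarrow> bool" where
  "finite_upto E S \<longleftrightarrow> (\<exists>F \<subseteq> S. finite F \<and> (\<forall>x \<in> S. \<exists>y \<in> F. E x y))"

definition tau_alpha :: "'a::comm_ring_1 rel \<Rightarrow> atom_kind \<Rightarrow> bool" where
  "tau_alpha \<tau> \<alpha> \<longleftrightarrow> (\<forall>a \<in> nonunits. \<exists>u as. tau_atom_fact \<tau> \<alpha> a u as)"

definition tau_ACCP :: "'a::comm_ring_1 rel \<Rightarrow> bool" where
  "tau_ACCP \<tau> \<longleftrightarrow>
     (\<forall>a :: nat \<Rightarrow> 'a.
        (\<forall>i. a i \<in> nonunits \<and> pideal (a i) \<subseteq> pideal (a (Suc i)) \<and>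
             tau_dvd \<tau> (a (Suc i)) (a i))
        \<longrightarrow> (\<exists>N. \<forall>n \<ge> N. pideal (a n) = pideal (a N)))"

definition tau_HFR :: "'a::comm_ring_1 rel \<Rightarrow> atom_kind \<Rightarrow> bool" where
  "tau_HFR \<tau> \<alpha> \<longleftrightarrow> tau_alpha \<tau> \<alpha> \<and>
     (\<forall>a \<in> nonunits. \<forall>u as v bs.
        tau_atom_fact \<tau> \<alpha> a u as \<and> tau_atom_fact \<tau> \<alpha> a v bs \<longrightarrow> length as = length bs)"

definition tau_UFR :: "'a::comm_ring_1 rel \<Rightarrow> atom_kind \<Rightarrow> assoc_kind \<Rightarrow> bool" where
  "tau_UFR \<tau> \<alpha> \<beta> \<longleftrightarrow> tau_HFR \<tau> \<alpha> \<and>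
     (\<forall>a \<in> nonunits. \<forall>u as v bs.
        tau_atom_fact \<tau> \<alpha> a u as \<and> tau_atom_fact \<tau> \<alpha> a v bs
        \<longrightarrow> rearr (assoc_rel \<beta>) as bs)"

definition tau_BFR :: "'a::comm_ring_1 rel \<Rightarrow> bool" where
  "tau_BFR \<tau> \<longleftrightarrow>
     (\<forall>a \<in> nonunits. \<exists>N. \<forall>u as. tau_fact \<tau> a u as \<longrightarrow> length as \<le> N)"

text \<open>In counting factorizations, the unit in front is disregarded.\<close>

definition tau_FFR :: "'a::comm_ring_1 rel \<Rightarrow> assoc_kind \<Rightarrow> bool" where
  "tau_FFR \<tau> \<beta> \<longleftrightarrow>
     (\<forall>a \<in> nonunits. finite_upto (rearr (assoc_rel \<beta>)\<^sup>=\<^sup>=)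
        {as. (\<exists>u. tau_fact \<tau> a u as) \<and> length as \<noteq> 1})"

definition tau_WFFR :: "'a::comm_ring_1 rel \<Rightarrow> assoc_kind \<Rightarrow> bool" where
  "tau_WFFR \<tau> \<beta> \<longleftrightarrow>
     (\<forall>a \<in> nonunits. finite_upto (assoc_rel \<beta>)\<^sup>=\<^sup>= {b. nontrivial_tau_dvd \<tau> b a})"

definition tau_df :: "'a::comm_ring_1 rel \<Rightarrow> atom_kind \<Rightarrow> assoc_kind \<Rightarrow> bool" where
  "tau_df \<tau> \<alpha> \<beta> \<longleftrightarrow>
     (\<forall>a \<in> nonunits. finite_upto (assoc_rel \<beta>)\<^sup>=\<^sup>= {b. tau_dvd \<tau> b a \<and> tau_atom \<tau> \<alpha> b})"

definition tau_r_fact :: "'a::comm_ring_1 rel \<Rightarrow> 'a \<Rightarrow> 'a \<Rightarrow> 'a list \<Rightarrow> bool" where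
  "tau_r_fact \<tau> a u as \<longleftrightarrow> a \<in> Reg \<and> tau_fact \<tau> a u as"

definition tau_r_irreducible :: "'a::comm_ring_1 rel \<Rightarrow> 'a \<Rightarrow> bool" where
  "tau_r_irreducible \<tau> a \<longleftrightarrow>
     a \<in> Reg_nonunits \<and> (\<forall>u as. tau_r_fact \<tau> a u as \<longrightarrow> (\<exists>b \<in> set as. assoc a b))"

definition tau_r_atomic_fact :: "'a::comm_ring_1 rel \<Rightarrow> 'a \<Rightarrow> 'a \<Rightarrow> 'a list \<Rightarrow> bool" where
  "tau_r_atomic_fact \<tau> a u as \<longleftrightarrow>
     tau_r_fact \<tau> a u as \<and> (\<forall>b \<in> set as. tau_r_irreducible \<tau> b)"

definition tau_r_atomic :: "'a::comm_ring_1 rel \<Rightarrow> bool" where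
  "tau_r_atomic \<tau> \<longleftrightarrow> (\<forall>a \<in> Reg_nonunits. \<exists>u as. tau_r_atomic_fact \<tau> a u as)"

definition tau_r_ACCP :: "'a::comm_ring_1 rel \<Rightarrow> bool" where
  "tau_r_ACCP \<tau> \<longleftrightarrow>
     \<not> (\<exists>a :: nat \<Rightarrow> 'a. \<forall>i. a i \<in> Reg \<and> pideal (a i) \<subset> pideal (a (Suc i)) \<and>
           (\<exists>u as. tau_r_fact \<tau> (a i) u as \<and> a (Suc i) \<in> set as))"

definition tau_r_HFR :: "'a::comm_ring_1 rel \<Rightarrow> bool" where
  "tau_r_HFR \<tau> \<longleftrightarrow> tau_r_atomic \<tau> \<and>
     (\<forall>a u as v bs. tau_r_atomic_fact \<tau> a u as \<and> tau_r_atomic_fact \<tau> a v bs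
        \<longrightarrow> length as = length bs)"

definition tau_r_UFR :: "'a::comm_ring_1 rel \<Rightarrow> bool" where
  "tau_r_UFR \<tau> \<longleftrightarrow> tau_r_HFR \<tau> \<and>
     (\<forall>a u as v bs. tau_r_atomic_fact \<tau> a u as \<and> tau_r_atomic_fact \<tau> a v bs
        \<longrightarrow> rearr assoc as bs)"

definition tau_r_BFR :: "'a::comm_ring_1 rel \<Rightarrow> bool" where
  "tau_r_BFR \<tau> \<longleftrightarrow>
     (\<forall>a \<in> Reg. \<exists>N. \<forall>u as. tau_r_fact \<tau> a u as \<longrightarrow> length as \<le> N)"

definition tau_r_idf :: "'a::comm_ring_1 rel \<Rightarrow> bool" where
  "tau_r_idf \<tau> \<longleftrightarrow>
     (\<forall>a \<in> Reg_nonunits. finite_upto assoc {b. tau_dvd \<tau> b a \<and> tau_r_irreducible \<tau> b})"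

definition tau_r_WFFR :: "'a::comm_ring_1 rel \<Rightarrow> bool" where
  "tau_r_WFFR \<tau> \<longleftrightarrow> (\<forall>a \<in> Reg_nonunits. finite_upto assoc {b. tau_dvd \<tau> b a})"

definition tau_r_FFR :: "'a::comm_ring_1 rel \<Rightarrow> bool" where
  "tau_r_FFR \<tau> \<longleftrightarrow>
     (\<forall>a \<in> Reg_nonunits. finite_upto (rearr assoc) {as. \<exists>u. tau_fact \<tau> a u as})"

end

theory Submission
  imports Defs
begin

text \<open>
  On regular elements all the notions of associate and of atom that the ring-wide properties
  refer to collapse. A regular \<open>a\<close> can be cancelled, so \<open>a = r * b\<close> and \<open>b = s * a\<close> force
  \<open>r * s = 1\<close>; hence the three kinds of associate agree with one another at \<open>a\<close>
  (\<open>assoc_rel_iff_assoc\<close>). Similarly, if a factor of a factorization of \<open>a\<close> is associate to \<open>a\<close>,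
  cancelling \<open>a\<close> shows that the product of the remaining factors is a unit; as factors are
  non-units, there are none left, and the factorization is trivial (\<open>assoc_factor_imp_trivial\<close>).
  Therefore each kind of atomicity of a regular non-unit says that it has only trivial
  factorizations, which is also what \<open>\<tau>\<close>-\<open>r\<close>-irreducibility says (\<open>tau_r_irreducible_iff\<close>).

  Factors of a regular element are regular, so nothing leaves the regular elements when one
  factors: for a regular \<open>a\<close>, the factorizations into \<open>\<tau>\<close>-\<open>r\<close>-irreducibles are exactly those into
  \<open>\<alpha>\<close>-atoms (\<open>tau_r_atomic_fact_iff\<close>). Each regular property is then the restriction of the
  ring-wide property to regular elements. The two finite factorization properties
  differ in one more respect: their ring-wide versions count the non-trivial factorizations, or
  the divisors occurring in them, and the regular ones count all; but the trivial factorizations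
  of \<open>a\<close> add only one class, as their only factor is associate to \<open>a\<close>.
\<close>

section \<open>Associates of regular elements\<close>

lemma assoc_iff_dvd: "assoc a b \<longleftrightarrow> a dvd b \<and> b dvd a"
proof -
  have "pideal c = {x. c dvd x}" for c :: 'a
    by (auto simp: pideal_def dvd_def mult.commute)
  then show ?thesis
    unfolding assoc_def by (auto intro: dvd_trans)
qed

lemma strong_assoc_imp_assoc:
  assumes "strong_assoc a b"
  shows "assoc a b"
proof -
  obtain u v where "a = u * b" and uv: "1 = u * v"
    using assms unfolding strong_assoc_def dvd_def by blast
  then have "v * a = b"
    by (metis mult.assoc mult.commute mult_1)
  then show ?thesis
    using \<open>a = u * b\<close> unfolding assoc_iff_dvd by (metis dvd_triv_right)
qed

lemma assoc_rel_imp_assoc: "assoc_rel \<beta> a b \<Longrightarrow> assoc a b"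
  by (cases \<beta>) (auto simp: strong_assoc_imp_assoc very_strong_assoc_def)

text \<open>The ring-wide finiteness properties count up to the reflexive closure of \<open>\<beta>\<close>, whereas the
  regular ones count up to associates.\<close>

lemma reflclp_assoc_rel_imp_assoc: "(assoc_rel \<beta>)\<^sup>=\<^sup>= a b \<Longrightarrow> assoc a b"
  by (metis assoc_def assoc_rel_imp_assoc sup2E)

lemma Reg_cancel:
  assumes "a \<in> Reg" and "a = a * c"
  shows "c = 1"
proof -
  have "a * (c - 1) = 0"
    using assms(2) by (simp add: algebra_simps)
  then have "c - 1 = 0"
    using assms(1) unfolding Reg_def by blast
  then show ?thesis by simp
qed

lemma Reg_dvd:
  assumes "a \<in> Reg" and "b dvd a"
  shows "b \<in> Reg"
  unfolding Reg_def
proof (intro CollectI allI impI)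
  fix c
  assume "b * c = 0"
  then have "a * c = 0"
    using assms(2) by (auto simp: dvd_def ac_simps)
  then show "c = 0"
    using assms(1) unfolding Reg_def by blast
qed

lemma assoc_rel_iff_assoc:
  assumes "a \<in> Reg"
  shows "assoc_rel \<beta> a b \<longleftrightarrow> assoc a b"
proof
  assume ab: "assoc a b"
  then obtain r s where r: "a = r * b" and s: "b = s * a"
    unfolding assoc_iff_dvd dvd_def by (metis mult.commute)
  have unit: "t dvd 1" if "a = t * b" for t
  proof -
    have "a = a * (t * s)"
      using that s by (metis mult.assoc mult.commute)
    then have "t * s = 1"
      using assms by (rule Reg_cancel[rotated])
    then show ?thesis by (metis dvd_triv_left)
  qed
  have "strong_assoc a b"
    using r unit strong_assoc_def by blast
  moreover have "very_strong_assoc a b"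
    using ab unit very_strong_assoc_def by blast
  ultimately show "assoc_rel \<beta> a b"
    using ab by (cases \<beta>) auto
qed (rule assoc_rel_imp_assoc)

section \<open>Factorizations and atoms among regular elements\<close>

lemma tau_fact_factor_dvd:
  assumes "tau_fact \<tau> a u as" and "b \<in> set as"
  shows "b dvd a"
  using assms unfolding tau_fact_def by (simp add: dvd_mult prod_list_dvd)

lemma tau_fact_factor_Reg_nonunits:
  assumes "a \<in> Reg" and "tau_fact \<tau> a u as" and "b \<in> set as"
  shows "b \<in> Reg_nonunits"
proof -
  have "b \<in> nonunits"
    using assms(2,3) unfolding tau_fact_def by blast
  then show ?thesis
    using Reg_dvd[OF assms(1) tau_fact_factor_dvd[OF assms(2,3)]]
    unfolding Reg_nonunits_def by blast
qed

lemma tau_fact_refl: "a \<in> nonunits \<Longrightarrow> tau_fact \<tau> a 1 [a]"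
  by (simp add: tau_fact_def)

lemma trivial_tau_fact_strong_assoc:
  assumes "tau_fact \<tau> a u as" and "length as = 1" and "b \<in> set as"
  shows "strong_assoc a b"
proof -
  have "as = [b]"
    using assms(2,3) by (auto simp: length_Suc_conv)
  then show ?thesis
    using assms(1) unfolding tau_fact_def strong_assoc_def by auto
qed

text \<open>Writing \<open>b = a * s\<close> and cancelling \<open>a\<close> from the factorization shows that the product of the
  factors other than \<open>b\<close> divides 1, so that any further factor would be a unit.\<close>

lemma assoc_factor_imp_trivial:
  assumes "a \<in> Reg" and fact: "tau_fact \<tau> a u as"
    and b: "b \<in> set as" and "assoc a b"
  shows "length as = 1"
proof -
  obtain xs ys where as: "as = xs @ b # ys"
    using b by (meson split_list)
  obtain s where s: "b = a * s"
    using \<open>assoc a b\<close> unfolding assoc_iff_dvd by blast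
  have "a = u * (prod_list xs * (b * prod_list ys))"
    using fact as unfolding tau_fact_def by simp
  also have "\<dots> = a * (u * s * prod_list (xs @ ys))"
    using s by (simp add: ac_simps)
  finally have unit: "u * s * prod_list (xs @ ys) = 1"
    by (rule Reg_cancel[OF \<open>a \<in> Reg\<close>])
  have "xs @ ys = []"
  proof (rule ccontr)
    assume "xs @ ys \<noteq> []"
    then obtain c where c: "c \<in> set (xs @ ys)"
      by (meson list.set_sel(1))
    then have "c dvd prod_list (xs @ ys)"
      by (rule prod_list_dvd)
    then have "c dvd 1"
      using unit by (metis dvd_mult)
    moreover have "c \<in> nonunits"
      using fact c as unfolding tau_fact_def by auto
    ultimately show False
      by (simp add: nonunits_def)
  qed
  then show ?thesis
    using as by simp
qed

lemma tau_atom_iff_only_trivial: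
  assumes "a \<in> Reg_nonunits"
  shows "tau_atom \<tau> \<alpha> a \<longleftrightarrow> (\<forall>u as. tau_fact \<tau> a u as \<longrightarrow> length as = 1)"
proof -
  have reg: "a \<in> Reg" and nonunit: "a \<in> nonunits"
    using assms unfolding Reg_nonunits_def by auto
  have "(\<exists>b \<in> set as. assoc a b) \<longleftrightarrow> length as = 1"
    and "(\<exists>b \<in> set as. strong_assoc a b) \<longleftrightarrow> length as = 1"
    and "(\<forall>b \<in> set as. assoc a b) \<longleftrightarrow> length as = 1"
    if fact: "tau_fact \<tau> a u as" for u as
  proof -
    obtain c where c: "c \<in> set as"
      using fact unfolding tau_fact_def by (cases as) auto
    have "strong_assoc a b" if "length as = 1" and "b \<in> set as" for b
      using trivial_tau_fact_strong_assoc[OF fact that] .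
    moreover have "length as = 1" if "b \<in> set as" and "assoc a b" for b
      using assoc_factor_imp_trivial[OF reg fact that] .
    ultimately show "(\<exists>b \<in> set as. assoc a b) \<longleftrightarrow> length as = 1"
      and "(\<exists>b \<in> set as. strong_assoc a b) \<longleftrightarrow> length as = 1"
      and "(\<forall>b \<in> set as. assoc a b) \<longleftrightarrow> length as = 1"
      using c strong_assoc_imp_assoc by metis+
  qed
  moreover have "very_strong_assoc a a"
    using assoc_rel_iff_assoc[OF reg, of Very_Strong_Associate a] by (simp add: assoc_def)
  ultimately show ?thesis
    using nonunit by (cases \<alpha>) simp_all
qed

lemma tau_r_irreducible_iff:
  assumes "a \<in> Reg_nonunits"
  shows "tau_r_irreducible \<tau> a \<longleftrightarrow> tau_atom \<tau> \<alpha> a"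
proof -
  have "tau_r_irreducible \<tau> a \<longleftrightarrow> tau_atom \<tau> Atomic a"
    using assms by (auto simp: tau_r_irreducible_def tau_r_fact_def Reg_nonunits_def)
  then show ?thesis
    using assms by (simp add: tau_atom_iff_only_trivial del: tau_atom.simps)
qed

lemma tau_r_atomic_fact_iff:
  assumes "a \<in> Reg"
  shows "tau_r_atomic_fact \<tau> a u as \<longleftrightarrow> tau_atom_fact \<tau> \<alpha> a u as"
  using assms tau_fact_factor_Reg_nonunits tau_r_irreducible_iff
  unfolding tau_r_atomic_fact_def tau_r_fact_def tau_atom_fact_def by metis

lemma tau_r_atomic_fact_imp:
  assumes "tau_r_atomic_fact \<tau> a u as"
  shows "a \<in> nonunits" and "tau_atom_fact \<tau> \<alpha> a u as"
proof -
  have "a \<in> Reg" and "a \<in> nonunits"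
    using assms unfolding tau_r_atomic_fact_def tau_r_fact_def tau_fact_def by auto
  then show "a \<in> nonunits" and "tau_atom_fact \<tau> \<alpha> a u as"
    using assms tau_r_atomic_fact_iff by blast+
qed

section \<open>Finiteness up to a relation\<close>

lemma rearr_mono:
  assumes "rearr E as bs" and "\<And>x y. E x y \<Longrightarrow> E' x y"
  shows "rearr E' as bs"
  using assms unfolding rearr_def by blast

lemma finite_upto_mono:
  assumes "finite_upto E S" and "\<And>x y. E x y \<Longrightarrow> E' x y"
  shows "finite_upto E' S"
  using assms unfolding finite_upto_def by meson

lemma finite_upto_add_class:
  assumes "finite_upto E S" and "S \<subseteq> T" and "t \<in> T"
    and "\<And>x. x \<in> T \<Longrightarrow> x \<notin> S \<Longrightarrow> E x t"
  shows "finite_upto E T"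
proof -
  obtain F where F: "F \<subseteq> S" "finite F" "\<forall>x \<in> S. \<exists>y \<in> F. E x y"
    using assms(1) unfolding finite_upto_def by blast
  have "insert t F \<subseteq> T"
    using F(1) assms(2,3) by blast
  moreover have "\<forall>x \<in> T. \<exists>y \<in> insert t F. E x y"
    using F(3) assms(4) by blast
  ultimately show ?thesis
    unfolding finite_upto_def using F(2) by blast
qed

section \<open>Restriction of the ring-wide properties to regular elements\<close>

lemma tau_alpha_imp_tau_r_atomic:
  assumes "tau_alpha \<tau> \<alpha>"
  shows "tau_r_atomic \<tau>"
  using assms tau_r_atomic_fact_iff
  unfolding tau_alpha_def tau_r_atomic_def Reg_nonunits_def by blast

lemma tau_HFR_imp_tau_r_HFR:
  assumes "tau_HFR \<tau> \<alpha>"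
  shows "tau_r_HFR \<tau>"
  unfolding tau_r_HFR_def
proof (intro conjI allI impI)
  show "tau_r_atomic \<tau>"
    using assms tau_alpha_imp_tau_r_atomic unfolding tau_HFR_def by blast
next
  fix a u as v bs
  assume "tau_r_atomic_fact \<tau> a u as \<and> tau_r_atomic_fact \<tau> a v bs"
  then show "length as = length bs"
    using assms tau_r_atomic_fact_imp unfolding tau_HFR_def by blast
qed

lemma tau_UFR_imp_tau_r_UFR:
  assumes "tau_UFR \<tau> \<alpha> \<beta>"
  shows "tau_r_UFR \<tau>"
  unfolding tau_r_UFR_def
proof (intro conjI allI impI)
  show "tau_r_HFR \<tau>"
    using assms tau_HFR_imp_tau_r_HFR unfolding tau_UFR_def by blast
next
  fix a u as v bs
  assume "tau_r_atomic_fact \<tau> a u as \<and> tau_r_atomic_fact \<tau> a v bs"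
  then have "rearr (assoc_rel \<beta>) as bs"
    using assms tau_r_atomic_fact_imp unfolding tau_UFR_def by blast
  then show "rearr assoc as bs"
    by (rule rearr_mono) (rule assoc_rel_imp_assoc)
qed

text \<open>The factorizations that are counted here but not in the hypothesis are the trivial ones,
  and these form the single class of \<open>[a]\<close>.\<close>

lemma tau_FFR_imp_tau_r_FFR:
  assumes "tau_FFR \<tau> \<beta>"
  shows "tau_r_FFR \<tau>"
  unfolding tau_r_FFR_def
proof
  fix a :: 'a
  assume "a \<in> Reg_nonunits"
  then have a: "a \<in> nonunits"
    unfolding Reg_nonunits_def by blast
  then have "finite_upto (rearr (assoc_rel \<beta>)\<^sup>=\<^sup>=) {as. (\<exists>u. tau_fact \<tau> a u as) \<and> length as \<noteq> 1}"
    using assms unfolding tau_FFR_def by blast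
  then have "finite_upto (rearr assoc) {as. (\<exists>u. tau_fact \<tau> a u as) \<and> length as \<noteq> 1}"
    by (rule finite_upto_mono) (erule rearr_mono, rule reflclp_assoc_rel_imp_assoc)
  then show "finite_upto (rearr assoc) {as. \<exists>u. tau_fact \<tau> a u as}"
  proof (rule finite_upto_add_class[where t = "[a]"])
    fix as
    assume "as \<in> {as. \<exists>u. tau_fact \<tau> a u as}"
      and "as \<notin> {as. (\<exists>u. tau_fact \<tau> a u as) \<and> length as \<noteq> 1}"
    then obtain u where u: "tau_fact \<tau> a u as" and len: "length as = 1"
      by blast
    then obtain b where as: "as = [b]"
      by (auto simp: length_Suc_conv)
    then have "b \<in> set as"
      by simp
    with u len have "assoc a b"
      by (intro strong_assoc_imp_assoc trivial_tau_fact_strong_assoc)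
    then have "\<forall>i < length as. assoc (as ! i) ([a] ! id i)"
      using as by (simp add: assoc_def)
    then show "rearr assoc as [a]"
      unfolding rearr_def using len permutes_id[of "{..<length as}"] by (metis length_Cons list.size(3) One_nat_def)
  next
    show "[a] \<in> {as. \<exists>u. tau_fact \<tau> a u as}"
      using tau_fact_refl[OF a] by (intro CollectI exI)
  qed blast
qed

lemma tau_WFFR_imp_tau_r_WFFR:
  assumes "tau_WFFR \<tau> \<beta>"
  shows "tau_r_WFFR \<tau>"
  unfolding tau_r_WFFR_def
proof
  fix a :: 'a
  assume "a \<in> Reg_nonunits"
  then have a: "a \<in> nonunits"
    unfolding Reg_nonunits_def by blast
  then have "finite_upto (assoc_rel \<beta>)\<^sup>=\<^sup>= {b. nontrivial_tau_dvd \<tau> b a}"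
    using assms unfolding tau_WFFR_def by blast
  then have "finite_upto assoc {b. nontrivial_tau_dvd \<tau> b a}"
    by (rule finite_upto_mono) (rule reflclp_assoc_rel_imp_assoc)
  then show "finite_upto assoc {b. tau_dvd \<tau> b a}"
  proof (rule finite_upto_add_class[where t = a])
    show "{b. nontrivial_tau_dvd \<tau> b a} \<subseteq> {b. tau_dvd \<tau> b a}"
      unfolding nontrivial_tau_dvd_def tau_dvd_def by blast
    show "a \<in> {b. tau_dvd \<tau> b a}"
      using tau_fact_refl[OF a, of \<tau>] unfolding tau_dvd_def
      by (intro CollectI exI[of _ 1] exI[of _ "[a]"]) simp
  next
    fix b
    assume "b \<in> {b. tau_dvd \<tau> b a}" and "b \<notin> {b. nontrivial_tau_dvd \<tau> b a}"
    then have "strong_assoc a b"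
      using trivial_tau_fact_strong_assoc unfolding tau_dvd_def nontrivial_tau_dvd_def by blast
    then show "assoc b a"
      using strong_assoc_imp_assoc unfolding assoc_def by metis
  qed
qed

lemma tau_df_imp_tau_r_idf:
  assumes "tau_df \<tau> \<alpha> \<beta>"
  shows "tau_r_idf \<tau>"
  unfolding tau_r_idf_def
proof
  fix a :: 'a
  assume "a \<in> Reg_nonunits"
  then have reg: "a \<in> Reg" and a: "a \<in> nonunits"
    unfolding Reg_nonunits_def by auto
  have "finite_upto (assoc_rel \<beta>)\<^sup>=\<^sup>= {b. tau_dvd \<tau> b a \<and> tau_atom \<tau> \<alpha> b}"
    using assms a unfolding tau_df_def by blast
  then have "finite_upto assoc {b. tau_dvd \<tau> b a \<and> tau_atom \<tau> \<alpha> b}"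
    by (rule finite_upto_mono) (rule reflclp_assoc_rel_imp_assoc)
  moreover have "tau_r_irreducible \<tau> b \<longleftrightarrow> tau_atom \<tau> \<alpha> b" if dvd: "tau_dvd \<tau> b a" for b
  proof -
    obtain u as where "tau_fact \<tau> a u as" and "b \<in> set as"
      using dvd unfolding tau_dvd_def by blast
    then show ?thesis
      by (intro tau_r_irreducible_iff tau_fact_factor_Reg_nonunits[OF reg])
  qed
  ultimately show "finite_upto assoc {b. tau_dvd \<tau> b a \<and> tau_r_irreducible \<tau> b}"
    by (simp cong: conj_cong)
qed

lemma tau_BFR_imp_tau_r_BFR:
  assumes "tau_BFR \<tau>"
  shows "tau_r_BFR \<tau>"
  unfolding tau_r_BFR_def
proof
  fix a :: 'a
  show "\<exists>N. \<forall>u as. tau_r_fact \<tau> a u as \<longrightarrow> length as \<le> N"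
  proof (cases "a \<in> nonunits")
    case True
    then obtain N where "\<forall>u as. tau_fact \<tau> a u as \<longrightarrow> length as \<le> N"
      using assms unfolding tau_BFR_def by blast
    then show ?thesis
      unfolding tau_r_fact_def by blast
  next
    (* A regular unit has no factorizations at all, so any bound does. *)
    case False
    then show ?thesis
      by (simp add: tau_r_fact_def tau_fact_def)
  qed
qed

lemma tau_ACCP_imp_tau_r_ACCP:
  assumes "tau_ACCP \<tau>"
  shows "tau_r_ACCP \<tau>"
  unfolding tau_r_ACCP_def
proof
  assume "\<exists>a :: nat \<Rightarrow> 'a. \<forall>i. a i \<in> Reg \<and> pideal (a i) \<subset> pideal (a (Suc i)) \<and>
            (\<exists>u as. tau_r_fact \<tau> (a i) u as \<and> a (Suc i) \<in> set as)"
  then obtain a :: "nat \<Rightarrow> 'a" where "\<forall>i. a i \<in> Reg \<and> pideal (a i) \<subset> pideal (a (Suc i)) \<and>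
            (\<exists>u as. tau_r_fact \<tau> (a i) u as \<and> a (Suc i) \<in> set as)" ..
  then have strict: "pideal (a i) \<subset> pideal (a (Suc i))"
    and fact: "\<exists>u as. tau_r_fact \<tau> (a i) u as \<and> a (Suc i) \<in> set as" for i
    by simp_all
  have "a i \<in> nonunits" for i
    using fact[of i] by (auto simp: tau_r_fact_def tau_fact_def)
  moreover have "tau_dvd \<tau> (a (Suc i)) (a i)" for i
    using fact[of i] by (auto simp: tau_r_fact_def tau_dvd_def)
  ultimately have "a i \<in> nonunits \<and> pideal (a i) \<subseteq> pideal (a (Suc i)) \<and>
      tau_dvd \<tau> (a (Suc i)) (a i)" for i
    using strict[of i] by simp
  then obtain N where "\<forall>n \<ge> N. pideal (a n) = pideal (a N)"
    using assms unfolding tau_ACCP_def by blast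
  then show False
    using strict[of N] by (metis le_SucI order_refl psubset_eq)
qed

theorem theorem5p1:
  fixes \<tau> :: "'a::comm_ring_1 rel"
    and \<alpha> :: atom_kind and \<beta> :: assoc_kind
  assumes "\<tau> \<subseteq> nonzero_nonunits \<times> nonzero_nonunits"
    and "sym \<tau>"
  shows "(tau_UFR \<tau> \<alpha> \<beta> \<longrightarrow> tau_r_UFR \<tau>) \<and>
         (tau_HFR \<tau> \<alpha> \<longrightarrow> tau_r_HFR \<tau>) \<and>
         (tau_FFR \<tau> \<beta> \<longrightarrow> tau_r_FFR \<tau>) \<and>
         (tau_WFFR \<tau> \<beta> \<longrightarrow> tau_r_WFFR \<tau>) \<and>
         (tau_df \<tau> \<alpha> \<beta> \<longrightarrow> tau_r_idf \<tau>) \<and>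
         (tau_BFR \<tau> \<longrightarrow> tau_r_BFR \<tau>) \<and>
         (tau_ACCP \<tau> \<longrightarrow> tau_r_ACCP \<tau>) \<and>
         (tau_alpha \<tau> \<alpha> \<longrightarrow> tau_r_atomic \<tau>)"
  using tau_UFR_imp_tau_r_UFR tau_HFR_imp_tau_r_HFR tau_FFR_imp_tau_r_FFR
    tau_WFFR_imp_tau_r_WFFR tau_df_imp_tau_r_idf tau_BFR_imp_tau_r_BFR
    tau_ACCP_imp_tau_r_ACCP tau_alpha_imp_tau_r_atomic
  by blast

end
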